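(* Let $1\le p<\infty$, $\alpha:=\min(p,2)$ and $q:=\max(p,2(p-1)^2)$. Let $k\in\mathbb N$ and $\rho\in\mathbb R^k$ with $\rho_1\ge\cdots\ge\rho_k>0$. Further, let $\gamma>0$, let $\beta_\ast:=\frac{2\gamma^{2-\alpha}}{q\,\rho_1^{\alpha}}$ and let $0\le\beta<\beta_\ast$. Then the functions $L_{\rho,\gamma},f_{\rho,\beta,\gamma}\colon\mathbb R^k\to\mathbb R$ given by $$L_{\rho,\gamma}(x):=\begin{cases}\sum_{j=1}^k\Big[(\gamma^2\rho_j^2+x_j^2)^{p/2}-(\gamma\rho_j)^p\Big]&\text{if }1\le p\le2,\\ \|x\|_p^2&\text{if }2<p<\infty,\end{cases}\qquad f_{\rho,\beta,\gamma}(x)=\sum_{j=1}^k\frac{x_j^2}{\rho_j^2}-\beta L_{\rho,\gamma}(x),$$ satisfy: (a) $\|x\|_p^\alpha-\gamma^\alpha\|\rho\|_p^\alpha\le L_{\rho,\gamma}(x)\le\|x\|_p^\alpha$ for any $x\in\mathbb R^k$; (b) $f_{\rho,\beta,\gamma}$ is non-negative; (c) $f_{\rho,\beta,\gamma}$ is convex.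
   Context: $\|x\|_p=\big(\sum_{j=1}^k|x_j|^p\big)^{1/p}$ denotes the $p$-norm on $\mathbb R^k$. *)

theory Defs
  imports "HOL-Analysis.Analysis"
begin

text \<open>
  Vectors in $R^k$ are rendered as \<^typ>\<open>real ^ 'n\<close> with a finite index type of size $k$. Where the
  order of the coordinates matters, the index type is in addition linearly ordered, so that it is
  order isomorphic to $1 < \dots < k$ and its first index is \<^term>\<open>Min UNIV\<close>.
\<close>

definition pnorm :: "real \<Rightarrow> real ^ 'n \<Rightarrow> real" where
  "pnorm p x = (\<Sum>j\<in>UNIV. \<bar>x $ j\<bar> powr p) powr (1 / p)"

definition alpha :: "real \<Rightarrow> real" where
  "alpha p = min p 2"

definition qexp :: "real \<Rightarrow> real" where
  "qexp p = max p (2 * (p - 1)\<^sup>2)"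

definition beta_star :: "real \<Rightarrow> real ^ ('n::{finite,linorder}) \<Rightarrow> real \<Rightarrow> real" where
  "beta_star p \<rho> \<gamma> =
     2 * \<gamma> powr (2 - alpha p) / (qexp p * (\<rho> $ Min UNIV) powr alpha p)"

definition Lfun :: "real \<Rightarrow> real ^ 'n \<Rightarrow> real \<Rightarrow> real ^ 'n \<Rightarrow> real" where
  "Lfun p \<rho> \<gamma> x =
     (if p \<le> 2
      then (\<Sum>j\<in>UNIV. (\<gamma>\<^sup>2 * (\<rho> $ j)\<^sup>2 + (x $ j)\<^sup>2) powr (p / 2) - (\<gamma> * \<rho> $ j) powr p)
      else (pnorm p x)\<^sup>2)"

definition ffun :: "real \<Rightarrow> real ^ 'n \<Rightarrow> real \<Rightarrow> real \<Rightarrow> real ^ 'n \<Rightarrow> real" where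
  "ffun p \<rho> \<beta> \<gamma> x = (\<Sum>j\<in>UNIV. (x $ j)\<^sup>2 / (\<rho> $ j)\<^sup>2) - \<beta> * Lfun p \<rho> \<gamma> x"

end

theory Submission
  imports Defs
begin

text \<open>
  The function f is even and vanishes at the origin, so (b) follows from (c). Convexity is checked
  along lines. For \<open>p \<le> 2\<close>, f is a sum of functions of one coordinate whose second derivatives are
  non-negative. For \<open>p > 2\<close>, put \<open>r = p / 2\<close> and replace the squared norm by the smooth function
  \<open>G = (\<Sum>j (e + x\<^sub>j\<^sup>2) powr r) powr (1 / r)\<close>. Writing \<open>G = \<Phi> powr (1 / r)\<close>, the term of the second
  derivative with the square of the first derivative of \<open>\<Phi>\<close> is non-positive, and each
  summand of \<open>\<Phi>\<close> is at most \<open>\<Phi>\<close>; hence the second derivative of \<open>G\<close> in direction \<open>v\<close> is at most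
  \<open>2 (p - 1) \<parallel>v\<parallel>\<^sup>2\<close>, uniformly in \<open>e > 0\<close>. Then let \<open>e\<close> tend to zero.
\<close>

section \<open>Subadditivity of powers with exponent at most 1\<close>

lemma powr_add_le_add_powr:
  fixes a b r :: real
  assumes "0 \<le> a" "0 \<le> b" "0 \<le> r" "r \<le> 1"
  shows "(a + b) powr r \<le> a powr r + b powr r"
proof (cases "a + b = 0")
  case True
  then show ?thesis using assms by simp
next
  case False
  define s where "s = a + b"
  have s: "s > 0" using False assms by (simp add: s_def)
  \<comment> \<open>\<open>s powr r\<close> is split in the proportions \<open>a / s\<close> and
    \<open>b / s\<close>. Each share is bounded separately, because \<open>powr (r - 1)\<close> is
    antitone for \<open>r \<le> 1\<close>.\<close>
  have aux: "(c / s) * s powr r \<le> c powr r" if "0 \<le> c" "c \<le> s" for c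
  proof (cases "c = 0")
    case False
    have "s powr (r - 1) \<le> c powr (r - 1)"
      using that False assms by (intro powr_mono2') auto
    then have "c * s powr (r - 1) \<le> c * c powr (r - 1)"
      using that by (intro mult_left_mono) auto
    then show ?thesis
      using that False s by (simp add: powr_diff)
  qed simp
  have "s powr r = (a / s) * s powr r + (b / s) * s powr r"
    using s by (simp add: s_def flip: distrib_right add_divide_distrib)
  also have "\<dots> \<le> a powr r + b powr r"
    using assms by (intro add_mono aux) (auto simp: s_def)
  finally show ?thesis by (simp add: s_def)
qed

lemma square_powr_half: "(x\<^sup>2) powr (p / 2) = \<bar>x\<bar> powr p" for x p :: real
proof -
  have "x\<^sup>2 = \<bar>x\<bar> powr 2" by simp
  then show ?thesis by (simp only: powr_powr) simp
qed

section \<open>General tools for convexity\<close>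

lemma convex_on_UNIV_lineI:
  fixes f :: "'a::real_vector \<Rightarrow> real"
  assumes "\<And>x v. convex_on UNIV (\<lambda>t::real. f (x + t *\<^sub>R v))"
  shows "convex_on UNIV f"
proof (rule convex_onI)
  fix t :: real and x y :: 'a
  assume "0 < t" "t < 1"
  then have "f (x + ((1 - t) *\<^sub>R 0 + t *\<^sub>R 1) *\<^sub>R (y - x))
      \<le> (1 - t) * f (x + 0 *\<^sub>R (y - x)) + t * f (x + 1 *\<^sub>R (y - x))"
    by (intro convex_onD[OF assms]) auto
  then show "f ((1 - t) *\<^sub>R x + t *\<^sub>R y) \<le> (1 - t) * f x + t * f y"
    by (simp add: algebra_simps)
qed simp

lemma convex_on_sum_functions:
  fixes f :: "'i \<Rightarrow> 'a::real_vector \<Rightarrow> real"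
  assumes "convex S" "\<And>i. i \<in> I \<Longrightarrow> convex_on S (f i)"
  shows "convex_on S (\<lambda>x. \<Sum>i\<in>I. f i x)"
  using assms(2)
  by (induction I rule: infinite_finite_induct)
     (auto simp: convex_on_const assms(1) intro!: convex_on_add)

text \<open>The origin is the midpoint of \<open>x\<close> and \<open>- x\<close>, so
  \<open>f 0\<close> is at most the average of two equal values \<open>f x\<close>.\<close>

lemma even_convex_nonneg:
  fixes f :: "'a::real_vector \<Rightarrow> real"
  assumes "convex_on UNIV f" "f 0 = 0" "\<And>x. f (- x) = f x"
  shows "0 \<le> f x"
proof -
  have "f ((1 - 1/2) *\<^sub>R x + (1/2) *\<^sub>R (- x)) \<le> (1 - 1/2) * f x + (1/2) * f (- x)"
    using assms(1) by (rule convex_onD) auto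
  moreover have "(1 - 1/2) *\<^sub>R x + (1/2) *\<^sub>R (- x) = 0" by (simp add: algebra_simps)
  ultimately show ?thesis using assms(2,3) by simp
qed

section \<open>Smoothed powers: derivatives and second-order bounds\<close>

lemma has_derivative_smoothed_power:
  fixes a r x v t :: real
  assumes "0 < a"
  shows "((\<lambda>t. (a + (x + t * v)\<^sup>2) powr r) has_real_derivative
           2 * r * v * ((x + t * v) * (a + (x + t * v)\<^sup>2) powr (r - 1))) (at t)"
proof -
  \<comment> \<open>The offset \<open>a\<close> keeps the base positive, so the power is
    differentiable even where \<open>x + t * v\<close> vanishes.\<close>
  have "a + (x + t * v)\<^sup>2 > 0" using assms by (simp add: add_pos_nonneg)
  then show ?thesis
    by (auto intro!: derivative_eq_intros)
qed

lemma has_second_derivative_smoothed_power: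
  fixes a r x v t :: real
  assumes "0 < a"
  shows "((\<lambda>t. 2 * r * v * ((x + t * v) * (a + (x + t * v)\<^sup>2) powr (r - 1))) has_real_derivative
           2 * r * v\<^sup>2 * ((a + (x + t * v)\<^sup>2) powr (r - 1)
             + 2 * (r - 1) * (x + t * v)\<^sup>2 * (a + (x + t * v)\<^sup>2) powr (r - 2))) (at t)"
proof -
  have "a + (x + t * v)\<^sup>2 > 0" using assms by (simp add: add_pos_nonneg)
  then show ?thesis
    by (auto intro!: derivative_eq_intros simp: power2_eq_square algebra_simps)
qed

text \<open>The hypothesis on \<open>c\<close> says that the second derivative is non-negative at
  \<open>t = 0\<close>. This is the worst point: for \<open>r \<le> 1\<close> the first term of the
  second derivative of the power is largest there, and the other term is never positive.\<close>

lemma convex_quadratic_minus_smoothed_power: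
  fixes a r \<beta> c :: real
  assumes "0 < a" "0 \<le> r" "r \<le> 1" "0 \<le> \<beta>" and c: "\<beta> * r * a powr (r - 1) \<le> c"
  shows "convex_on UNIV (\<lambda>t. c * t\<^sup>2 - \<beta> * ((a + t\<^sup>2) powr r))"
proof -
  have d1: "((\<lambda>t. (a + t\<^sup>2) powr r) has_real_derivative
      2 * r * (t * (a + t\<^sup>2) powr (r - 1))) (at t)" for t
    using has_derivative_smoothed_power[OF \<open>0 < a\<close>, of 0 1 r t] by simp
  have d2: "((\<lambda>t. 2 * r * (t * (a + t\<^sup>2) powr (r - 1))) has_real_derivative
      2 * r * ((a + t\<^sup>2) powr (r - 1) + 2 * (r - 1) * t\<^sup>2 * (a + t\<^sup>2) powr (r - 2))) (at t)" for t
    using has_second_derivative_smoothed_power[OF \<open>0 < a\<close>, of r 1 0 t] by simp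
  show ?thesis
  proof (rule f''_ge0_imp_convex)
    fix t :: real
    show "((\<lambda>t. c * t\<^sup>2 - \<beta> * ((a + t\<^sup>2) powr r)) has_real_derivative
        2 * c * t - \<beta> * (2 * r * (t * (a + t\<^sup>2) powr (r - 1)))) (at t)"
      by (intro DERIV_diff DERIV_cmult d1) (auto intro!: derivative_eq_intros)
    show "((\<lambda>t. 2 * c * t - \<beta> * (2 * r * (t * (a + t\<^sup>2) powr (r - 1)))) has_real_derivative
        2 * c - \<beta> * (2 * r * ((a + t\<^sup>2) powr (r - 1)
          + 2 * (r - 1) * t\<^sup>2 * (a + t\<^sup>2) powr (r - 2)))) (at t)"
      by (rule DERIV_diff d2 DERIV_cmult_Id DERIV_cmult)+
    have "(r - 1) * (2 * t\<^sup>2 * (a + t\<^sup>2) powr (r - 2)) \<le> 0"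
      using assms by (intro mult_nonpos_nonneg) auto
    then have "2 * (r - 1) * t\<^sup>2 * (a + t\<^sup>2) powr (r - 2) \<le> 0"
      by (simp only: mult_ac)
    moreover have "(a + t\<^sup>2) powr (r - 1) \<le> a powr (r - 1)"
      using assms by (intro powr_mono2') auto
    ultimately have "(a + t\<^sup>2) powr (r - 1) + 2 * (r - 1) * t\<^sup>2 * (a + t\<^sup>2) powr (r - 2)
        \<le> a powr (r - 1)" by linarith
    then have "\<beta> * (2 * r * ((a + t\<^sup>2) powr (r - 1)
        + 2 * (r - 1) * t\<^sup>2 * (a + t\<^sup>2) powr (r - 2))) \<le> \<beta> * (2 * r * a powr (r - 1))"
      using assms by (intro mult_left_mono) auto
    then show "0 \<le> 2 * c - \<beta> * (2 * r * ((a + t\<^sup>2) powr (r - 1)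
        + 2 * (r - 1) * t\<^sup>2 * (a + t\<^sup>2) powr (r - 2)))"
      using c by simp
  qed simp
qed

text \<open>The second derivative of the quadratic part is twice the sum of
  \<open>c j * (v j)\<^sup>2\<close>, which dominates \<open>\<beta>\<close> times the bound
  \<open>2 * (2 * r - 1) * V\<close> for the smoothed norm. The condition on \<open>c\<close> does
  not involve \<open>a\<close>, so \<open>a\<close> may later tend to zero.\<close>

lemma convex_quadratic_minus_smoothed_norm:
  fixes c x v :: "'n::finite \<Rightarrow> real" and a r \<beta> :: real
  assumes a: "0 < a" and r: "1 \<le> r" and \<beta>: "0 \<le> \<beta>" and c: "\<And>j. \<beta> * (2 * r - 1) \<le> c j"
  shows "convex_on UNIV (\<lambda>t. (\<Sum>j\<in>UNIV. c j * (x j + t * v j)\<^sup>2)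
    - \<beta> * (\<Sum>j\<in>UNIV. (a + (x j + t * v j)\<^sup>2) powr r) powr (1 / r))"
proof -
  define S where "S j t = a + (x j + t * v j)\<^sup>2" for j t
  define \<Phi> where "\<Phi> t = (\<Sum>j\<in>UNIV. S j t powr r)" for t
  define \<Phi>' where "\<Phi>' t = (\<Sum>j\<in>UNIV. 2 * r * v j * ((x j + t * v j) * S j t powr (r - 1)))" for t
  define \<Phi>'' where "\<Phi>'' t = (\<Sum>j\<in>UNIV. 2 * r * (v j)\<^sup>2 * (S j t powr (r - 1)
             + 2 * (r - 1) * (x j + t * v j)\<^sup>2 * S j t powr (r - 2)))" for t
  define V where "V = (\<Sum>j\<in>UNIV. (v j)\<^sup>2)"
  have S: "S j t > 0" for j t
    using a by (simp add: S_def add_pos_nonneg)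
  have \<Phi>: "\<Phi> t > 0" for t
    unfolding \<Phi>_def using S by (intro sum_pos) (auto simp: less_imp_neq[symmetric])
  have d1: "(\<Phi> has_real_derivative \<Phi>' t) (at t)" for t
    unfolding \<Phi>_def \<Phi>'_def S_def by (intro DERIV_sum has_derivative_smoothed_power a)
  have d2: "(\<Phi>' has_real_derivative \<Phi>'' t) (at t)" for t
    unfolding \<Phi>'_def \<Phi>''_def S_def by (intro DERIV_sum has_second_derivative_smoothed_power a)
  define G' where "G' t = (1 / r) * (\<Phi> t powr (1 / r - 1) * \<Phi>' t)" for t
  define G'' where "G'' t = (1 / r) * (\<Phi> t powr (1 / r - 1) * \<Phi>'' t
      + (1 / r - 1) * \<Phi> t powr (1 / r - 2) * (\<Phi>' t)\<^sup>2)" for t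
  have g1: "((\<lambda>t. \<Phi> t powr (1 / r)) has_real_derivative G' t) (at t)" for t
    unfolding G'_def by (auto intro!: derivative_eq_intros d1 \<Phi>)
  have g2: "(G' has_real_derivative G'' t) (at t)" for t
  proof -
    have "((\<lambda>t. \<Phi> t powr (1 / r - 1)) has_real_derivative
        (1 / r - 1) * \<Phi> t powr (1 / r - 1 - 1) * \<Phi>' t) (at t)"
      by (rule DERIV_chain2[OF has_real_derivative_powr d1]) (rule \<Phi>)
    from DERIV_cmult[OF DERIV_mult[OF this d2], of "1 / r"] show ?thesis
      unfolding G'_def[abs_def] G''_def by (simp add: power2_eq_square algebra_simps)
  qed
  have \<Phi>''_le: "\<Phi>'' t \<le> 2 * r * (2 * r - 1) * \<Phi> t powr (1 - 1 / r) * V" for t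
  proof -
    have "2 * r * (v j)\<^sup>2 * (S j t powr (r - 1) + 2 * (r - 1) * (x j + t * v j)\<^sup>2 * S j t powr (r - 2))
        \<le> 2 * r * (v j)\<^sup>2 * ((2 * r - 1) * \<Phi> t powr (1 - 1 / r))" for j
    proof (rule mult_left_mono)
      \<comment> \<open>The square is absorbed into one factor \<open>S j t\<close>, so both terms
        become multiples of \<open>S j t powr (r - 1)\<close>, with total factor
        \<open>1 + 2 * (r - 1) = 2 * r - 1\<close>.\<close>
      have "(x j + t * v j)\<^sup>2 * S j t powr (r - 2) \<le> S j t * S j t powr (r - 2)"
        using a by (intro mult_right_mono) (auto simp: S_def)
      also have "\<dots> = S j t powr (r - 1)"
        using S[of j t] powr_mult_base[of "S j t" "r - 2"] by simp
      finally have "2 * (r - 1) * ((x j + t * v j)\<^sup>2 * S j t powr (r - 2))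
          \<le> 2 * (r - 1) * S j t powr (r - 1)"
        using r by (intro mult_left_mono) auto
      then have "S j t powr (r - 1) + 2 * (r - 1) * (x j + t * v j)\<^sup>2 * S j t powr (r - 2)
          \<le> (2 * r - 1) * S j t powr (r - 1)"
        by (simp add: algebra_simps)
      \<comment> \<open>Since \<open>r * (1 - 1 / r) = r - 1\<close>, this exposes the summand
        \<open>S j t powr r\<close> of \<open>\<Phi> t\<close>; the outer exponent is non-negative,
        so the comparison with \<open>\<Phi> t\<close> is preserved.\<close>
      also have "\<dots> = (2 * r - 1) * (S j t powr r) powr (1 - 1 / r)"
        using r by (simp add: powr_powr right_diff_distrib)
      also have "\<dots> \<le> (2 * r - 1) * \<Phi> t powr (1 - 1 / r)"
        using r unfolding \<Phi>_def by (intro mult_left_mono powr_mono2 member_le_sum) auto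
      finally show "S j t powr (r - 1) + 2 * (r - 1) * (x j + t * v j)\<^sup>2 * S j t powr (r - 2)
          \<le> (2 * r - 1) * \<Phi> t powr (1 - 1 / r)" .
    qed (use r in auto)
    then have "\<Phi>'' t \<le> (\<Sum>j\<in>UNIV. 2 * r * (v j)\<^sup>2 * ((2 * r - 1) * \<Phi> t powr (1 - 1 / r)))"
      unfolding \<Phi>''_def by (intro sum_mono)
    also have "\<dots> = 2 * r * (2 * r - 1) * \<Phi> t powr (1 - 1 / r) * V"
      unfolding V_def sum_distrib_left by (simp only: mult_ac)
    finally show ?thesis .
  qed
  have G''_le: "G'' t \<le> 2 * (2 * r - 1) * V" for t
  proof -
    have "(1 / r - 1) * \<Phi> t powr (1 / r - 2) * (\<Phi>' t)\<^sup>2 \<le> 0"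
      using r by (intro mult_nonpos_nonneg) auto
    moreover have "\<Phi> t powr (1 / r - 1) * \<Phi>'' t
        \<le> \<Phi> t powr (1 / r - 1) * (2 * r * (2 * r - 1) * \<Phi> t powr (1 - 1 / r) * V)"
      by (intro mult_left_mono \<Phi>''_le) auto
    moreover have "\<dots> = (\<Phi> t powr (1 / r - 1) * \<Phi> t powr (1 - 1 / r)) * (2 * r * (2 * r - 1) * V)"
      by (simp add: mult_ac)
    \<comment> \<open>The powers of \<open>\<Phi> t\<close> cancel, leaving a bound that depends on
      neither \<open>t\<close> nor \<open>a\<close>.\<close>
    moreover have "\<Phi> t powr (1 / r - 1) * \<Phi> t powr (1 - 1 / r) = 1"
      using \<Phi>[of t] by (simp flip: powr_add)
    ultimately have "\<Phi> t powr (1 / r - 1) * \<Phi>'' t + (1 / r - 1) * \<Phi> t powr (1 / r - 2) * (\<Phi>' t)\<^sup>2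
        \<le> 2 * r * (2 * r - 1) * V" by simp
    then have "G'' t \<le> (1 / r) * (2 * r * (2 * r - 1) * V)"
      unfolding G''_def using r by (intro mult_left_mono) auto
    also have "\<dots> = 2 * (2 * r - 1) * V" using r by simp
    finally show ?thesis .
  qed
  have "convex_on UNIV (\<lambda>t. (\<Sum>j\<in>UNIV. c j * (x j + t * v j)\<^sup>2) - \<beta> * \<Phi> t powr (1 / r))"
  proof (rule f''_ge0_imp_convex)
    fix t :: real
    show "((\<lambda>t. (\<Sum>j\<in>UNIV. c j * (x j + t * v j)\<^sup>2) - \<beta> * \<Phi> t powr (1 / r)) has_real_derivative
        (\<Sum>j\<in>UNIV. c j * (2 * v j * (x j + t * v j))) - \<beta> * G' t) (at t)"
      by (intro DERIV_diff DERIV_cmult g1 DERIV_sum) (auto intro!: derivative_eq_intros)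
    show "((\<lambda>t. (\<Sum>j\<in>UNIV. c j * (2 * v j * (x j + t * v j))) - \<beta> * G' t) has_real_derivative
        (\<Sum>j\<in>UNIV. c j * (2 * v j * v j)) - \<beta> * G'' t) (at t)"
      by (intro DERIV_diff DERIV_cmult g2 DERIV_sum) (auto intro!: derivative_eq_intros)
    have "\<beta> * G'' t \<le> \<beta> * (2 * (2 * r - 1) * V)"
      by (intro mult_left_mono G''_le \<beta>)
    also have "\<dots> = (\<Sum>j\<in>UNIV. (\<beta> * (2 * r - 1)) * (2 * v j * v j))"
      unfolding V_def sum_distrib_left power2_eq_square by (simp only: mult_ac)
    also have "\<dots> \<le> (\<Sum>j\<in>UNIV. c j * (2 * v j * v j))"
      by (intro sum_mono mult_right_mono c) auto
    finally show "0 \<le> (\<Sum>j\<in>UNIV. c j * (2 * v j * v j)) - \<beta> * G'' t" by simp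
  qed simp
  then show ?thesis by (simp add: \<Phi>_def S_def)
qed

text \<open>Each instance of convexity is a non-strict inequality between finitely many values,
  hence survives pointwise limits.\<close>

lemma convex_on_UNIV_limit:
  fixes f :: "'a::real_vector \<Rightarrow> real"
  assumes lim: "\<And>x. ((\<lambda>e. g e x) \<longlongrightarrow> f x) F" and "F \<noteq> bot"
    and ev: "eventually (\<lambda>e. convex_on UNIV (g e)) F"
  shows "convex_on UNIV f"
proof (rule convex_onI)
  fix t :: real and x y :: 'a
  assume "0 < t" "t < 1"
  then have "eventually (\<lambda>e. g e ((1 - t) *\<^sub>R x + t *\<^sub>R y) \<le> (1 - t) * g e x + t * g e y) F"
    using ev by (auto elim!: eventually_mono intro: convex_onD)
  then show "f ((1 - t) *\<^sub>R x + t *\<^sub>R y) \<le> (1 - t) * f x + t * f y"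
    by (intro tendsto_le[OF \<open>F \<noteq> bot\<close> _ lim]) (auto intro!: tendsto_intros lim)
qed simp

section \<open>The p-norm and the bounds (a)\<close>

lemma pnorm_powr:
  assumes "p > 0"
  shows "pnorm p x powr p = (\<Sum>j\<in>UNIV. \<bar>x $ j\<bar> powr p)"
  using assms by (simp add: pnorm_def powr_powr sum_nonneg)

lemma pnorm_powr_2: "pnorm p x powr 2 = (pnorm p x)\<^sup>2"
  by (simp add: pnorm_def)

text \<open>This is the form of the smoothed norm with \<open>r = p / 2\<close> and offset
  zero.\<close>

lemma pnorm_square:
  "(pnorm p x)\<^sup>2 = (\<Sum>j\<in>UNIV. ((x $ j)\<^sup>2) powr (p / 2)) powr (1 / (p / 2))"
  by (simp add: square_powr_half powr_powr flip: pnorm_powr_2) (simp add: pnorm_def powr_powr)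

text \<open>For \<open>p \<le> 2\<close> both bounds hold coordinatewise: the lower one by
  monotonicity of \<open>powr (p / 2)\<close>, the upper one by its subadditivity. For
  \<open>p > 2\<close> the upper bound is an equality and the lower one subtracts a non-negative
  term.\<close>

lemma Lfun_bounds:
  fixes \<rho> :: "real ^ 'n"
  assumes p: "1 \<le> p" and \<rho>: "\<And>j. \<rho> $ j > 0" and \<gamma>: "\<gamma> > 0"
  shows "pnorm p x powr alpha p - \<gamma> powr alpha p * pnorm p \<rho> powr alpha p \<le> Lfun p \<rho> \<gamma> x"
    and "Lfun p \<rho> \<gamma> x \<le> pnorm p x powr alpha p"
proof -
  show "pnorm p x powr alpha p - \<gamma> powr alpha p * pnorm p \<rho> powr alpha p \<le> Lfun p \<rho> \<gamma> x"
  proof (cases "p \<le> 2")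
    case True
    have "pnorm p x powr p - \<gamma> powr p * pnorm p \<rho> powr p
        = (\<Sum>j\<in>UNIV. ((x $ j)\<^sup>2) powr (p / 2) - (\<gamma> * \<rho> $ j) powr p)"
      using p \<rho> \<gamma>
      by (simp add: pnorm_powr square_powr_half sum_subtractf sum_distrib_left powr_mult less_imp_le)
    also have "\<dots> \<le> Lfun p \<rho> \<gamma> x"
      using True p by (auto simp: Lfun_def intro!: sum_mono powr_mono2)
    finally show ?thesis using True by (simp add: alpha_def)
  qed (auto simp: alpha_def Lfun_def pnorm_powr_2)
  show "Lfun p \<rho> \<gamma> x \<le> pnorm p x powr alpha p"
  proof (cases "p \<le> 2")
    case True
    have "(\<gamma>\<^sup>2 * (\<rho> $ j)\<^sup>2 + (x $ j)\<^sup>2) powr (p / 2) - (\<gamma> * \<rho> $ j) powr p \<le> \<bar>x $ j\<bar> powr p" for j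
      using powr_add_le_add_powr[of "(\<gamma> * \<rho> $ j)\<^sup>2" "(x $ j)\<^sup>2" "p / 2"] True p \<rho>[of j] \<gamma>
      unfolding square_powr_half by (simp add: power_mult_distrib abs_mult)
    then show ?thesis
      using True p by (simp add: Lfun_def alpha_def pnorm_powr sum_mono)
  qed (auto simp: alpha_def Lfun_def pnorm_powr_2)
qed

section \<open>Convexity of f in the two ranges of p\<close>

lemma ffun_convex_p_le_2:
  fixes \<rho> :: "real ^ 'n"
  assumes p: "1 \<le> p" "p \<le> 2" and \<rho>: "\<And>j. \<rho> $ j > 0" and \<gamma>: "\<gamma> > 0" and \<beta>: "0 \<le> \<beta>"
    and \<beta>_le: "\<And>j. \<beta> * (p * (\<rho> $ j) powr p) \<le> 2 * \<gamma> powr (2 - p)"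
  shows "convex_on UNIV (ffun p \<rho> \<beta> \<gamma>)"
proof -
  have conv: "convex_on UNIV (\<lambda>t. 1 / (\<rho> $ j)\<^sup>2 * t\<^sup>2 - \<beta> * (((\<gamma> * \<rho> $ j)\<^sup>2 + t\<^sup>2) powr (p / 2)))" for j
  proof (rule convex_quadratic_minus_smoothed_power)
    have pos: "\<gamma> * \<rho> $ j > 0" using \<gamma> \<rho>[of j] by simp
    then show "0 < (\<gamma> * \<rho> $ j)\<^sup>2" by (rule zero_less_power)
    have "((\<gamma> * \<rho> $ j)\<^sup>2) powr (p / 2 - 1) = (\<gamma> * \<rho> $ j) powr (p - 2)"
      using square_powr_half[of "\<gamma> * \<rho> $ j" "p - 2"] pos by (simp add: diff_divide_distrib)
    also have "\<dots> = (\<rho> $ j) powr p / (\<gamma> powr (2 - p) * (\<rho> $ j)\<^sup>2)"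
      using \<gamma> \<rho>[of j] by (simp add: powr_mult powr_diff)
    finally have *: "((\<gamma> * \<rho> $ j)\<^sup>2) powr (p / 2 - 1)
        = (\<rho> $ j) powr p / (\<gamma> powr (2 - p) * (\<rho> $ j)\<^sup>2)" .
    \<comment> \<open>After clearing denominators this one-dimensional criterion is exactly
      \<open>\<beta>_le\<close>.\<close>
    show "\<beta> * (p / 2) * ((\<gamma> * \<rho> $ j)\<^sup>2) powr (p / 2 - 1) \<le> 1 / (\<rho> $ j)\<^sup>2"
      unfolding * using \<beta>_le[of j] \<gamma> \<rho>[of j] by (simp add: divide_simps mult_ac)
  qed (use p \<beta> in auto)
  \<comment> \<open>Convexity lifts to vectors because taking a coordinate is linear. The added
    constant makes the summands add up to \<open>ffun\<close>.\<close>
  have "convex_on UNIV (\<lambda>x :: real ^ 'n. 1 / (\<rho> $ j)\<^sup>2 * (x $ j)\<^sup>2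
      - \<beta> * (((\<gamma> * \<rho> $ j)\<^sup>2 + (x $ j)\<^sup>2) powr (p / 2)) + \<beta> * (\<gamma> * \<rho> $ j) powr p)" for j
  proof (rule convex_onI)
    fix t :: real and x y :: "real ^ 'n"
    assume "0 < t" "t < 1"
    then show "1 / (\<rho> $ j)\<^sup>2 * (((1 - t) *\<^sub>R x + t *\<^sub>R y) $ j)\<^sup>2
      - \<beta> * (((\<gamma> * \<rho> $ j)\<^sup>2 + (((1 - t) *\<^sub>R x + t *\<^sub>R y) $ j)\<^sup>2) powr (p / 2))
      + \<beta> * (\<gamma> * \<rho> $ j) powr p
      \<le> (1 - t) * (1 / (\<rho> $ j)\<^sup>2 * (x $ j)\<^sup>2
      - \<beta> * (((\<gamma> * \<rho> $ j)\<^sup>2 + (x $ j)\<^sup>2) powr (p / 2)) + \<beta> * (\<gamma> * \<rho> $ j) powr p)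
      + t * (1 / (\<rho> $ j)\<^sup>2 * (y $ j)\<^sup>2
      - \<beta> * (((\<gamma> * \<rho> $ j)\<^sup>2 + (y $ j)\<^sup>2) powr (p / 2)) + \<beta> * (\<gamma> * \<rho> $ j) powr p)"
      using convex_onD[OF conv[of j], of t "x $ j" "y $ j"] by (simp add: algebra_simps)
  qed simp
  then have "convex_on UNIV (\<lambda>x :: real ^ 'n. \<Sum>j\<in>UNIV. 1 / (\<rho> $ j)\<^sup>2 * (x $ j)\<^sup>2
      - \<beta> * (((\<gamma> * \<rho> $ j)\<^sup>2 + (x $ j)\<^sup>2) powr (p / 2)) + \<beta> * (\<gamma> * \<rho> $ j) powr p)"
    by (intro convex_on_sum_functions) auto
  also have "(\<lambda>x :: real ^ 'n. \<Sum>j\<in>UNIV. 1 / (\<rho> $ j)\<^sup>2 * (x $ j)\<^sup>2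
      - \<beta> * (((\<gamma> * \<rho> $ j)\<^sup>2 + (x $ j)\<^sup>2) powr (p / 2)) + \<beta> * (\<gamma> * \<rho> $ j) powr p)
      = ffun p \<rho> \<beta> \<gamma>"
    using p by (simp add: fun_eq_iff ffun_def Lfun_def power_mult_distrib right_diff_distrib
        sum_subtractf sum.distrib sum_distrib_left)
  finally show ?thesis .
qed

lemma ffun_convex_p_gt_2:
  fixes \<rho> :: "real ^ 'n"
  assumes p: "2 < p" and \<rho>: "\<And>j. \<rho> $ j > 0" and \<beta>: "0 \<le> \<beta>"
    and \<beta>_le: "\<And>j. \<beta> * (p - 1) \<le> 1 / (\<rho> $ j)\<^sup>2"
  shows "convex_on UNIV (ffun p \<rho> \<beta> \<gamma>)"
proof (rule convex_on_UNIV_limit)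
  let ?g = "\<lambda>e (x :: real ^ 'n). (\<Sum>j\<in>UNIV. 1 / (\<rho> $ j)\<^sup>2 * (x $ j)\<^sup>2)
    - \<beta> * (\<Sum>j\<in>UNIV. (e + (x $ j)\<^sup>2) powr (p / 2)) powr (1 / (p / 2))"
  have "convex_on UNIV (?g e)" if "e > 0" for e
  proof (rule convex_on_UNIV_lineI)
    fix x v :: "real ^ 'n"
    show "convex_on UNIV (\<lambda>t. ?g e (x + t *\<^sub>R v))"
      \<comment> \<open>With \<open>r = p / 2\<close> the factor \<open>2 * r - 1\<close> is
        \<open>p - 1\<close>, as in \<open>\<beta>_le\<close>.\<close>
      using convex_quadratic_minus_smoothed_norm[OF that, of "p / 2" \<beta>
          "\<lambda>j. 1 / (\<rho> $ j)\<^sup>2" "($) x" "($) v"] p \<beta> \<beta>_le by simp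
  qed
  then show "eventually (\<lambda>e. convex_on UNIV (?g e)) (at_right 0)"
    by (simp add: eventually_at_filter)
  fix x :: "real ^ 'n"
  \<comment> \<open>Bases may vanish at \<open>e = 0\<close>; continuity of \<open>powr\<close>
    there rests on positive exponents and non-negative bases.\<close>
  have "((\<lambda>e. ?g e x) \<longlongrightarrow> ?g 0 x) (at_right 0)"
    using p
    by (intro tendsto_intros tendsto_powr' disjI2 conjI)
       (auto simp: eventually_at_filter intro!: always_eventually sum_nonneg)
  moreover have "?g 0 x = ffun p \<rho> \<beta> \<gamma> x"
    using p by (simp add: ffun_def Lfun_def pnorm_square)
  ultimately show "((\<lambda>e. ?g e x) \<longlongrightarrow> ffun p \<rho> \<beta> \<gamma> x) (at_right 0)" by simp
qed simp

section \<open>Value at the origin, symmetry, and the assembly of (a), (b) and (c)\<close>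

lemma ffun_0: "p \<noteq> 0 \<Longrightarrow> (\<And>j. \<rho> $ j > 0) \<Longrightarrow> \<gamma> > 0 \<Longrightarrow> ffun p \<rho> \<beta> \<gamma> 0 = 0"
  \<comment> \<open>For \<open>p \<le> 2\<close> the constant subtracted in \<open>Lfun\<close>
    cancels the smoothed power at the origin.\<close>
  using square_powr_half[of "\<gamma> * \<rho> $ j" p for j]
  by (simp add: ffun_def Lfun_def pnorm_def power_mult_distrib abs_mult less_imp_le)

lemma ffun_minus: "ffun p \<rho> \<beta> \<gamma> (- x) = ffun p \<rho> \<beta> \<gamma> x"
  by (simp add: ffun_def Lfun_def pnorm_def)

theorem proposition4p6:
  fixes p \<beta> \<gamma> :: real
    and \<rho> :: "real ^ ('n::{finite,linorder})"
  assumes "1 \<le> p"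
    and "\<And>i j. i \<le> j \<Longrightarrow> \<rho> $ j \<le> \<rho> $ i"
    and "\<And>j. \<rho> $ j > 0"
    and "\<gamma> > 0"
    and "0 \<le> \<beta>" and "\<beta> < beta_star p \<rho> \<gamma>"
  shows "(\<forall>x. pnorm p x powr alpha p - \<gamma> powr alpha p * pnorm p \<rho> powr alpha p \<le> Lfun p \<rho> \<gamma> x
              \<and> Lfun p \<rho> \<gamma> x \<le> pnorm p x powr alpha p)
       \<and> (\<forall>x. ffun p \<rho> \<beta> \<gamma> x \<ge> 0)
       \<and> convex_on UNIV (ffun p \<rho> \<beta> \<gamma>)"
proof -
  define R where "R = \<rho> $ Min UNIV"
  have R: "R > 0" "\<rho> $ j \<le> R" for j
    using assms(2,3) by (auto simp: R_def)
  have conv: "convex_on UNIV (ffun p \<rho> \<beta> \<gamma>)"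
  proof (cases "p \<le> 2")
    case True
    \<comment> \<open>The factorization shows that the maximum in \<open>qexp\<close> switches
      branch at \<open>p = 2\<close>.\<close>
    have "2 * (p - 1)\<^sup>2 - p = (2 * p - 1) * (p - 2)"
      by (simp add: power2_eq_square algebra_simps)
    also have "\<dots> \<le> 0"
      using True assms(1) by (intro mult_nonneg_nonpos) auto
    finally have q: "qexp p = p" by (simp add: qexp_def)
    have *: "\<beta> * (p * R powr p) \<le> 2 * \<gamma> powr (2 - p)"
      using assms(1,6) True R(1) by (simp add: beta_star_def q alpha_def R_def[symmetric] field_simps)
    show ?thesis
    proof (rule ffun_convex_p_le_2)
      fix j
      have "\<beta> * (p * (\<rho> $ j) powr p) \<le> \<beta> * (p * R powr p)"
        using assms(1,3,5) R by (intro mult_left_mono powr_mono2) (auto simp: less_imp_le)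
      with * show "\<beta> * (p * (\<rho> $ j) powr p) \<le> 2 * \<gamma> powr (2 - p)" by simp
    qed (use assms True in auto)
  next
    case False
    have "0 \<le> (2 * p - 1) * (p - 2)" using False by simp
    also have "\<dots> = 2 * (p - 1)\<^sup>2 - p"
      by (simp add: power2_eq_square algebra_simps)
    finally have q: "qexp p = 2 * (p - 1)\<^sup>2" by (simp add: qexp_def)
    \<comment> \<open>Here \<open>alpha p = 2\<close>, so the power of \<open>\<gamma>\<close> is 1
      and the threshold is \<open>1 / ((p - 1)\<^sup>2 * R\<^sup>2)\<close>.\<close>
    have *: "\<beta> * ((p - 1)\<^sup>2 * R\<^sup>2) \<le> 1"
      using assms(4,6) False R(1)
      by (simp add: beta_star_def q alpha_def R_def[symmetric] field_simps)
    show ?thesis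
    proof (rule ffun_convex_p_gt_2)
      fix j
      \<comment> \<open>For \<open>p > 2\<close> the factor \<open>p - 1\<close> exceeds 1, so it is
        at most its square.\<close>
      have "\<beta> * ((p - 1) * (\<rho> $ j)\<^sup>2) \<le> \<beta> * ((p - 1)\<^sup>2 * R\<^sup>2)"
        using False assms(3,5) R(2)
        by (intro mult_left_mono mult_mono power_mono) (auto simp: less_imp_le power2_eq_square)
      with * show "\<beta> * (p - 1) \<le> 1 / (\<rho> $ j)\<^sup>2"
        using assms(3)[of j] by (simp add: field_simps)
    qed (use assms False in auto)
  qed
  moreover have "0 \<le> ffun p \<rho> \<beta> \<gamma> x" for x
    using conv assms by (intro even_convex_nonneg ffun_0 ffun_minus) auto
  ultimately show ?thesis
    using Lfun_bounds[OF assms(1,3,4)] by blast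
qed

end
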